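(* For every integer $n\geq 3$, the lattice $(P\!E_{n},\leq_{\mathrm{dref}})$ is EL-shellable.
   Context: Write $[n]=\{1,\dots,n\}$. A set partition $\mathbf{x}$ of $[n]$ is noncrossing if for all $1\leq i<j<k<l\leq n$, whenever $i,k$ lie in a common block and $j,l$ lie in a common block, then $i,j$ lie in a common block; write $i\sim_{\mathbf{x}}j$ if $i,j$ lie in the same block. $NC_{n}$ is the set of noncrossing set partitions of $[n]$, and $\leq_{\mathrm{dref}}$ (dual refinement) is defined by $\mathbf{x}\leq_{\mathrm{dref}}\mathbf{y}$ iff every block of $\mathbf{x}$ is contained in a block of $\mathbf{y}$. For $n\geq 3$, $P\!E_{n}$ is the set of all $\mathbf{x}\in NC_{n}$ such that $\{n-1,n\}$ is not a block of $\mathbf{x}$, and it is not the case that both $1\sim_{\mathbf{x}}n-1$ and $\{n\}$ is a block of $\mathbf{x}$. $(P\!E_{n},\leq_{\mathrm{dref}})$ is the induced subposet of $(NC_{n},\leq_{\mathrm{dref}})$ on $P\!E_{n}$; it is a lattice. EL-labeling: an edge-labeling of a finite bounded poset $\mathcal{L}$ is a map $\lambda$ from its set of cover relations to some poset $(\Lambda,\prec)$. A saturated chain $x_{1}\lessdot\cdots\lessdot x_{k}$ has label sequence $(\lambda(x_{1},x_{2}),\ldots,\lambda(x_{k-1},x_{k}))$ and is rising if this sequence is strictly increasing with respect to $\prec$. $\lambda$ is an EL-labeling if for every interval $[x,y]$ of $\mathcal{L}$: (i) there is a unique rising maximal chain $C$ in $[x,y]$, and (ii) for every other maximal chain $C'$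 of $[x,y]$ the label sequence of $C$ is lexicographically smaller than that of $C'$. A poset is EL-shellable if it admits an EL-labeling. *)

theory Defs
  imports "HOL-Library.Disjoint_Sets"
begin

section \<open>Noncrossing partitions and dual refinement\<close>

definition same_block :: "'a set set \<Rightarrow> 'a \<Rightarrow> 'a \<Rightarrow> bool" where
  "same_block P i j \<longleftrightarrow> (\<exists>B\<in>P. i \<in> B \<and> j \<in> B)"

definition NC :: "nat \<Rightarrow> nat set set set" where
  "NC n = {P. partition_on {1..n} P \<and>
     (\<forall>i j k l. 1 \<le> i \<and> i < j \<and> j < k \<and> k < l \<and> l \<le> n \<longrightarrow>
        same_block P i k \<longrightarrow> same_block P j l \<longrightarrow> same_block P i j)}"

definition PE :: "nat \<Rightarrow> nat set set set" where
  "PE n = {P \<in> NC n. {n - 1, n} \<notin> P \<and> \<not> (same_block P 1 (n - 1) \<and> {n} \<in> P)}"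

definition dref :: "nat \<Rightarrow> nat set set rel" where
  "dref n = {(P, Q). refines {1..n} P Q}"


section \<open>EL-shellability of finite bounded posets\<close>

text \<open>A poset is a carrier \<open>A\<close> with a reflexive order relation \<open>r\<close>, as in
  \<^const>\<open>partial_order_on\<close>; in particular \<open>r \<subseteq> A \<times> A\<close>.\<close>

definition finite_bounded_poset :: "'a set \<Rightarrow> 'a rel \<Rightarrow> bool" where
  "finite_bounded_poset A r \<longleftrightarrow> finite A \<and> partial_order_on A r \<and>
     (\<exists>b\<in>A. \<forall>x\<in>A. (b, x) \<in> r) \<and> (\<exists>t\<in>A. \<forall>x\<in>A. (x, t) \<in> r)"

definition covers :: "'a rel \<Rightarrow> 'a rel" where
  "covers r = {(x, y). (x, y) \<in> r \<and> x \<noteq> y \<and>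
     \<not> (\<exists>z. (x, z) \<in> r \<and> (z, y) \<in> r \<and> z \<noteq> x \<and> z \<noteq> y)}"

text \<open>In a finite poset the maximal chains of an interval \<open>[x, y]\<close> are the saturated chains
  \<open>x = x\<^sub>1 \<lessdot> \<dots> \<lessdot> x\<^sub>k = y\<close>.\<close>

definition maximal_chains :: "'a rel \<Rightarrow> 'a \<Rightarrow> 'a \<Rightarrow> 'a list set" where
  "maximal_chains r x y = {c. c \<noteq> [] \<and> hd c = x \<and> last c = y \<and>
     successively (\<lambda>u v. (u, v) \<in> covers r) c}"

definition label_seq :: "('a \<times> 'a \<Rightarrow> 'l) \<Rightarrow> 'a list \<Rightarrow> 'l list" where
  "label_seq lab c = map lab (zip c (tl c))"

text \<open>The label poset is \<open>(L, s)\<close> with \<open>s\<close> reflexive; its strict part is \<open>s - Id\<close>.\<close>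

definition rising :: "'l rel \<Rightarrow> ('a \<times> 'a \<Rightarrow> 'l) \<Rightarrow> 'a list \<Rightarrow> bool" where
  "rising s lab c \<longleftrightarrow> sorted_wrt (\<lambda>a b. (a, b) \<in> s - Id) (label_seq lab c)"

definition EL_labeling ::
  "'a set \<Rightarrow> 'a rel \<Rightarrow> 'l set \<Rightarrow> 'l rel \<Rightarrow> ('a \<times> 'a \<Rightarrow> 'l) \<Rightarrow> bool" where
  "EL_labeling A r L s lab \<longleftrightarrow>
     finite_bounded_poset A r \<and> partial_order_on L s \<and> lab ` covers r \<subseteq> L \<and>
     (\<forall>(x, y)\<in>r.
        (\<exists>!C. C \<in> maximal_chains r x y \<and> rising s lab C) \<and>
        (\<forall>C C'. C \<in> maximal_chains r x y \<longrightarrow> rising s lab C \<longrightarrow>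
           C' \<in> maximal_chains r x y \<longrightarrow> C' \<noteq> C \<longrightarrow>
           (label_seq lab C, label_seq lab C') \<in> lexord (s - Id)))"

text \<open>Labels may be taken to be natural numbers without loss of generality, because a finite
  poset has finitely many cover relations and hence uses finitely many labels. The order \<open>s\<close>
  on them is an arbitrary partial order, unrelated to the usual one.\<close>

definition EL_shellable :: "'a set \<Rightarrow> 'a rel \<Rightarrow> bool" where
  "EL_shellable A r \<longleftrightarrow>
     (\<exists>(L :: nat set) (s :: nat rel) (lab :: 'a \<times> 'a \<Rightarrow> nat). EL_labeling A r L s lab)"

end

theory Submission
  imports Defs
begin

text \<open>Rotate the points so that \<open>n\<close> comes first, and label a cover by the unique block minimum that
  it removes. Every maximal chain of an interval \<open>[u, v]\<close> then carries the same set of labels, namely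
  the minima of blocks of \<open>u\<close> that are not minima of blocks of \<open>v\<close>. A rising chain has to remove the
  smallest of these, \<open>m\<close>, first; it can only do so by merging the block with minimum \<open>m\<close> into the
  block containing the minimum of the surrounding block of \<open>v\<close>. In the rotated order, this merge
  neither creates a crossing nor leaves \<open>PE n\<close>.\<close>

section \<open>Label sequences and recursive decomposition of saturated chains\<close>

lemma label_seq_Cons2: "label_seq lab (x # y # c) = lab (x, y) # label_seq lab (y # c)"
  by (simp add: label_seq_def)

lemma label_seq_single: "label_seq lab [x] = []"
  by (simp add: label_seq_def)

lemma maximal_chains_Cons2_iff:
  "u # z # c \<in> maximal_chains r x y \<longleftrightarrow> u = x \<and> (x, z) \<in> covers r \<and> z # c \<in> maximal_chains r z y"
  by (auto simp: maximal_chains_def)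

lemma maximal_chains_single_iff: "[u] \<in> maximal_chains r x y \<longleftrightarrow> u = x \<and> x = y"
  by (auto simp: maximal_chains_def)

lemma maximal_chains_cases:
  assumes "C \<in> maximal_chains r x y"
  obtains "C = [x]" "x = y"
  | z c where "C = x # z # c" "(x, z) \<in> covers r" "z # c \<in> maximal_chains r z y"
proof (cases C rule: remdups_adj.cases)
  case 1
  with assms show ?thesis by (simp add: maximal_chains_def)
next
  case (2 u)
  with assms that(1) show ?thesis by (simp add: maximal_chains_single_iff)
next
  case (3 u z c)
  with assms that(2) show ?thesis by (simp add: maximal_chains_Cons2_iff)
qed

section \<open>An abstract criterion for EL-labelings\<close>

locale greedy_labeled_poset =
  fixes A :: "'a set" and r :: "'a rel" and M :: "'a \<Rightarrow> 'l::linorder set"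
  assumes bounded: "finite_bounded_poset A r"
    and finite_M: "u \<in> A \<Longrightarrow> finite (M u)"
    and M_antimono: "(u, v) \<in> r \<Longrightarrow> M v \<subseteq> M u"
    and greedy_step: "(u, v) \<in> r \<Longrightarrow> u \<noteq> v \<Longrightarrow> M u - M v \<noteq> {} \<and>
      (\<exists>w. (u, w) \<in> r \<and> (w, v) \<in> r \<and> M w = M u - {Min (M u - M v)} \<and>
        (\<forall>w'. (u, w') \<in> r \<longrightarrow> (w', v) \<in> r \<longrightarrow> Min (M u - M v) \<notin> M w' \<longrightarrow> (w, w') \<in> r))"
begin

text \<open>Only the values on covers matter; there the difference turns out to be a singleton, so
  \<open>Min\<close> just extracts its element.\<close>

definition min_lab :: "'a \<times> 'a \<Rightarrow> 'l" where
  "min_lab = (\<lambda>(u, v). Min (M u - M v))"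

lemma partial_order: "partial_order_on A r"
  using bounded by (simp add: finite_bounded_poset_def)

lemma in_carrier: "(u, v) \<in> r \<Longrightarrow> u \<in> A \<and> v \<in> A"
  using partial_order by (auto simp: partial_order_on_def preorder_on_def)

lemma r_refl: "u \<in> A \<Longrightarrow> (u, u) \<in> r"
  using partial_order by (auto simp: partial_order_on_def preorder_on_def refl_on_def)

lemma r_trans: "(u, v) \<in> r \<Longrightarrow> (v, w) \<in> r \<Longrightarrow> (u, w) \<in> r"
  using partial_order by (meson partial_order_on_def preorder_on_def transD)

lemma r_antisym: "(u, v) \<in> r \<Longrightarrow> (v, u) \<in> r \<Longrightarrow> u = v"
  using partial_order by (meson partial_order_on_def antisymD)

lemma Min_diff_mem:
  assumes "(u, v) \<in> r" "u \<noteq> v"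
  shows "Min (M u - M v) \<in> M u - M v"
  using greedy_step[OF assms] finite_M in_carrier[OF assms(1)] by (intro Min_in) auto

lemma covers_in_r: "(u, v) \<in> covers r \<Longrightarrow> (u, v) \<in> r \<and> u \<noteq> v"
  by (simp add: covers_def)

text \<open>The greedy step inside a cover produces an element of the interval different from
  \<open>u\<close>, which can only be \<open>v\<close>.\<close>

lemma covers_M:
  assumes "(u, v) \<in> covers r"
  shows "min_lab (u, v) \<in> M u" "M v = M u - {min_lab (u, v)}"
proof -
  have uv: "(u, v) \<in> r" "u \<noteq> v"
    using covers_in_r[OF assms] by auto
  show "min_lab (u, v) \<in> M u"
    using Min_diff_mem[OF uv] by (simp add: min_lab_def)
  obtain w where w: "(u, w) \<in> r" "(w, v) \<in> r" "M w = M u - {Min (M u - M v)}"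
    using greedy_step[OF uv] by blast
  have "w \<noteq> u"
    using w(3) Min_diff_mem[OF uv] by blast
  then have "w = v"
    using assms w(1,2) by (auto simp: covers_def)
  then show "M v = M u - {min_lab (u, v)}"
    using w(3) by (simp add: min_lab_def)
qed

lemma maximal_chains_in_r:
  "C \<in> maximal_chains r x y \<Longrightarrow> y \<in> A \<Longrightarrow> (x, y) \<in> r"
proof (induction C arbitrary: x)
  case Nil
  then show ?case by (simp add: maximal_chains_def)
next
  case (Cons u C)
  from Cons.prems(1) show ?case
  proof (cases rule: maximal_chains_cases)
    case 1
    then show ?thesis using Cons.prems r_refl by simp
  next
    case (2 z c)
    then show ?thesis
      using Cons.IH[of z] Cons.prems(2) covers_in_r r_trans by fastforce
  qed
qed

text \<open>Telescopes \<open>covers_M\<close> along the chain: each cover drops exactly its own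
  label, and by antimonotonicity a dropped label never returns.\<close>

lemma set_label_seq:
  "C \<in> maximal_chains r x y \<Longrightarrow> y \<in> A \<Longrightarrow> set (label_seq min_lab C) = M x - M y"
proof (induction C arbitrary: x)
  case Nil
  then show ?case by (simp add: maximal_chains_def)
next
  case (Cons u C)
  from Cons.prems(1) show ?case
  proof (cases rule: maximal_chains_cases)
    case 1
    then show ?thesis by (simp add: label_seq_single)
  next
    case (2 z c)
    have "set (label_seq min_lab (z # c)) = M z - M y"
      using 2 Cons.IH[of z] Cons.prems(2) by simp
    moreover have "M y \<subseteq> M z"
      using maximal_chains_in_r[OF 2(3) Cons.prems(2)] M_antimono by blast
    ultimately show ?thesis
      using covers_M[OF 2(2)] 2(1) by (auto simp: label_seq_Cons2)
  qed
qed

abbreviation lt :: "'l rel" where "lt \<equiv> {(a, b). a \<le> b} - Id"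

text \<open>Induction on the number of labels still to be lost: go first to the greedy element
  \<open>w\<close>, then follow a rising chain from \<open>w\<close>, whose labels all exceed
  \<open>m\<close>.\<close>

lemma exists_rising_chain:
  assumes "(x, y) \<in> r"
  shows "\<exists>C. C \<in> maximal_chains r x y \<and> rising {(a, b). a \<le> b} min_lab C"
  using assms
proof (induction "card (M x - M y)" arbitrary: x rule: less_induct)
  case less
  show ?case
  proof (cases "x = y")
    case True
    then have "[x] \<in> maximal_chains r x y \<and> rising {(a, b). a \<le> b} min_lab [x]"
      by (simp add: maximal_chains_single_iff rising_def label_seq_single)
    then show ?thesis by blast
  next
    case False
    define m where "m = Min (M x - M y)"
    note xy = \<open>(x, y) \<in> r\<close> False
    have fin: "finite (M x)"
      using finite_M in_carrier[OF xy(1)] by blast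
    have m: "m \<in> M x - M y"
      unfolding m_def by (rule Min_diff_mem[OF xy])
    obtain w where w: "(x, w) \<in> r" "(w, y) \<in> r" "M w = M x - {m}"
      unfolding m_def using greedy_step[OF xy] by blast
    \<comment> \<open>An element strictly between \<open>x\<close> and \<open>w\<close> would force
      two successive losses of labels, but \<open>w\<close> has lost only \<open>m\<close>.\<close>
    have "z = w" if "(x, z) \<in> r" "(z, w) \<in> r" "z \<noteq> x" for z
    proof (rule ccontr)
      assume "z \<noteq> w"
      have "\<not> M x \<subseteq> M z" "\<not> M z \<subseteq> M w"
        using Min_diff_mem[OF that(1) that(3)[symmetric]] Min_diff_mem[OF that(2) \<open>z \<noteq> w\<close>]
        by blast+
      then show False
        using M_antimono[OF that(1)] M_antimono[OF that(2)] w(3) by blast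
    qed
    then have cov: "(x, w) \<in> covers r"
      using w m by (auto simp: covers_def)
    have "card (M w - M y) < card (M x - M y)"
      using w(3) m fin by (intro psubset_card_mono) auto
    from less.hyps[OF this w(2)] obtain C where
      C: "C \<in> maximal_chains r w y" "rising {(a, b). a \<le> b} min_lab C"
      by blast
    have lab: "min_lab (x, w) = m"
      using w(3) m covers_M[OF cov] by blast
    have m_less: "m < l" if "l \<in> set (label_seq min_lab C)" for l
    proof -
      have "l \<in> M x - M y" "l \<noteq> m"
        using that set_label_seq[OF C(1)] in_carrier[OF xy(1)] w(3) by auto
      then show ?thesis
        using fin unfolding m_def by (metis Min_le finite_Diff order_less_le)
    qed
    from C(1) have "x # C \<in> maximal_chains r x y \<and> rising {(a, b). a \<le> b} min_lab (x # C)"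
    proof (cases rule: maximal_chains_cases)
      case 1
      then show ?thesis
        using cov
        by (simp add: maximal_chains_Cons2_iff maximal_chains_single_iff
            rising_def label_seq_Cons2 label_seq_single)
    next
      case (2 z c)
      then show ?thesis
        using cov C lab m_less
        by (auto simp: maximal_chains_Cons2_iff rising_def label_seq_Cons2 less_imp_le)
    qed
    then show ?thesis by blast
  qed
qed

text \<open>Both chains carry the same label set, and the rising one starts with its minimum
  \<open>m\<close>. Either the other chain starts with a larger label, or both start with
  \<open>m\<close>; then both pass first to the same element and induction applies to the
  tails.\<close>

lemma rising_chain_lex_smallest:
  assumes "C \<in> maximal_chains r x y" "rising {(a, b). a \<le> b} min_lab C"
    and "C' \<in> maximal_chains r x y" "C' \<noteq> C" "y \<in> A"
  shows "(label_seq min_lab C, label_seq min_lab C') \<in> lexord lt"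
  using assms
proof (induction C arbitrary: x C')
  case Nil
  then show ?case by (simp add: maximal_chains_def)
next
  case (Cons u D)
  \<comment> \<open>Antisymmetry excludes chains with a genuine step in a one-point interval, which
    settles the mixed cases below.\<close>
  have no_loop: False if "(x, z) \<in> covers r" "z # c \<in> maximal_chains r z y" "x = y" for z c
    using that maximal_chains_in_r[OF that(2) \<open>y \<in> A\<close>] covers_in_r[OF that(1)] r_antisym by blast
  from Cons.prems(1) show ?case
  proof (cases rule: maximal_chains_cases)
    case 1
    from Cons.prems(3) show ?thesis
    proof (cases rule: maximal_chains_cases)
      case 1
      then show ?thesis using \<open>u # D = [x]\<close> Cons.prems(4) by simp
    next
      case (2 z c)
      then show ?thesis using no_loop 1 by blast
    qed
  next
    case C: (2 z c)
    from Cons.prems(3) show ?thesis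
    proof (cases rule: maximal_chains_cases)
      case 1
      then show ?thesis using no_loop C by blast
    next
      case C': (2 z' c')
      have xy: "(x, y) \<in> r"
        using maximal_chains_in_r Cons.prems by blast
      have "x \<noteq> y" using no_loop C by blast
      have fin: "finite (M x)"
        using finite_M in_carrier[OF xy] by blast
      define m where "m = Min (M x - M y)"
      have m: "m \<in> M x - M y"
        unfolding m_def by (rule Min_diff_mem[OF xy \<open>x \<noteq> y\<close>])
      have labs: "set (label_seq min_lab (u # D)) = M x - M y"
          "set (label_seq min_lab C') = M x - M y"
        using set_label_seq Cons.prems by blast+
      have ge: "m \<le> l" if "l \<in> M x - M y" for l
        unfolding m_def using fin that by simp
      have "min_lab (x, z) \<le> l" if "l \<in> M x - M y" for l
      proof -
        have "l \<in> set (label_seq min_lab (x # z # c))"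
          using that labs(1) C(1) by simp
        then show ?thesis
          using Cons.prems(2) C(1) by (auto simp: rising_def label_seq_Cons2)
      qed
      moreover have "min_lab (x, z) \<in> M x - M y"
        using labs(1) C(1) by (auto simp: label_seq_Cons2)
      ultimately have lz: "min_lab (x, z) = m"
        using m ge by (meson order_antisym)
      have lz': "min_lab (x, z') \<in> M x - M y"
        using labs(2) C'(1) by (auto simp: label_seq_Cons2)
      show ?thesis
      proof (cases "min_lab (x, z') = m")
        case False
        then have "m < min_lab (x, z')"
          using ge lz' by (metis order_le_less)
        then show ?thesis
          using C(1) C'(1) lz by (simp add: label_seq_Cons2 less_imp_le less_imp_neq)
      next
        case True
        obtain w where w: "(x, w) \<in> r" "(w, y) \<in> r" "M w = M x - {m}"
            "\<And>w'. (x, w') \<in> r \<Longrightarrow> (w', y) \<in> r \<Longrightarrow> m \<notin> M w' \<Longrightarrow> (w, w') \<in> r"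
          unfolding m_def using greedy_step[OF xy \<open>x \<noteq> y\<close>] by blast
        have "w \<noteq> x" using w(3) m by blast
        \<comment> \<open>Leastness of \<open>w\<close> puts it below \<open>q\<close>; as
          \<open>q\<close> covers \<open>x\<close> and \<open>w\<close> differs from
          \<open>x\<close>, the two coincide.\<close>
        have eq_w: "q = w" if "(x, q) \<in> covers r" "q # d \<in> maximal_chains r q y"
          "min_lab (x, q) = m" for q d
        proof -
          have "m \<notin> M q" using covers_M[OF that(1)] that(3) by blast
          then have "(w, q) \<in> r"
            using w(4) that(1,2) covers_in_r maximal_chains_in_r \<open>y \<in> A\<close> by blast
          then show ?thesis
            using that(1) w(1) \<open>w \<noteq> x\<close> by (auto simp: covers_def)
        qed
        have "z = z'"
          using eq_w C C' lz True by metis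
        have D: "D = z # c" using C(1) by simp
        have "(label_seq min_lab D, label_seq min_lab (z' # c')) \<in> lexord lt"
        proof (rule Cons.IH)
          show "D \<in> maximal_chains r z y" using C D by simp
          show "rising {(a, b). a \<le> b} min_lab D"
            using Cons.prems(2) C(1) D by (simp add: rising_def label_seq_Cons2)
          show "z' # c' \<in> maximal_chains r z y" using C' \<open>z = z'\<close> by simp
          show "z' # c' \<noteq> D" using Cons.prems(4) C(1) C'(1) D by simp
        qed fact
        then show ?thesis
          using C(1) C'(1) D lz True by (simp add: label_seq_Cons2)
      qed
    qed
  qed
qed

theorem EL_labeling_min_lab: "EL_labeling A r UNIV {(a, b). a \<le> b} min_lab"
proof -
  have "partial_order_on UNIV {(a::'l, b). a \<le> b}"
    by (auto simp: partial_order_on_def preorder_on_def refl_on_def trans_def antisym_def)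
  \<comment> \<open>Two distinct rising chains would each be lexicographically smaller than the
    other, so uniqueness follows from minimality.\<close>
  moreover have "C = C'"
    if "C \<in> maximal_chains r x y" "rising {(a, b). a \<le> b} min_lab C"
      "C' \<in> maximal_chains r x y" "rising {(a, b). a \<le> b} min_lab C'" "y \<in> A" for x y C C'
  proof (rule ccontr)
    assume "C \<noteq> C'"
    then have "(label_seq min_lab C, label_seq min_lab C') \<in> lexord lt"
      "(label_seq min_lab C', label_seq min_lab C) \<in> lexord lt"
      using rising_chain_lex_smallest that by metis+
    moreover have "trans lt"
      by (auto simp: trans_def)
    ultimately have "(label_seq min_lab C, label_seq min_lab C) \<in> lexord lt"
      using lexord_trans by blast
    then show False
      by (metis (no_types, lifting) DiffD2 IdI lexord_irreflexive)
  qed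
  ultimately show ?thesis
    unfolding EL_labeling_def
    using bounded exists_rising_chain rising_chain_lex_smallest in_carrier
    by (auto 0 3)
qed

end

section \<open>Blocks of set partitions under refinement and merging\<close>

lemma partition_on_block_eq:
  "partition_on A P \<Longrightarrow> B \<in> P \<Longrightarrow> C \<in> P \<Longrightarrow> x \<in> B \<Longrightarrow> x \<in> C \<Longrightarrow> B = C"
  by (metis disjnt_iff pairwiseD partition_onD2)

lemma partition_on_ex_block:
  assumes "partition_on A P" "x \<in> A"
  shows "\<exists>B\<in>P. x \<in> B"
  using assms partition_onD1 by blast

lemma refines_block_subset:
  assumes "refines A P Q" "B \<in> P" "D \<in> Q" "x \<in> B" "x \<in> D"
  shows "B \<subseteq> D"
proof -
  obtain D' where D': "D' \<in> Q" "B \<subseteq> D'"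
    using assms(1,2) by (auto simp: refines_def)
  moreover have "partition_on A Q"
    using assms(1) by (simp add: refines_def)
  ultimately have "D' = D"
    using partition_on_block_eq assms(3-5) by (metis subsetD)
  then show ?thesis using D' by simp
qed

lemma partition_on_merge:
  assumes P: "partition_on A P" "B \<in> P" "C \<in> P"
  shows "partition_on A (insert (B \<union> C) (P - {B, C}))"
proof (rule partition_onI)
  show "\<Union> (insert (B \<union> C) (P - {B, C})) = A"
    using P partition_onD1 by blast
  have disj: "disjnt p q" if "p \<in> P" "q \<in> P" "p \<noteq> q" for p q
    using pairwiseD[OF partition_onD2[OF P(1)]] that by simp
  have "disjnt (B \<union> C) q" if "q \<in> P - {B, C}" for q
    using that disj[of B q] disj[of C q] P(2,3) by (auto simp only: disjnt_Un1)
  then show "disjnt p q"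
    if "p \<in> insert (B \<union> C) (P - {B, C})" "q \<in> insert (B \<union> C) (P - {B, C})" "p \<noteq> q" for p q
    using that disj by (metis Diff_iff disjnt_sym insertE)
  show "{} \<notin> insert (B \<union> C) (P - {B, C})"
    using P partition_onD3[OF P(1)] by auto
qed

section \<open>Crossing blocks and cyclic rotation\<close>

text \<open>The key \<open>f\<close> lets points be compared in a rotated order. The relation is not
  symmetric: the first of the four alternating points belongs to \<open>B\<close>.\<close>

definition crossing :: "('a \<Rightarrow> 'b::linorder) \<Rightarrow> 'a set \<Rightarrow> 'a set \<Rightarrow> bool" where
  "crossing f B C \<longleftrightarrow>
     (\<exists>a\<in>B. \<exists>b\<in>B. \<exists>c\<in>C. \<exists>d\<in>C. f a < f c \<and> f c < f b \<and> f b < f d)"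

lemma crossing_mono: "crossing f B C \<Longrightarrow> B \<subseteq> B' \<Longrightarrow> C \<subseteq> C' \<Longrightarrow> crossing f B' C'"
  unfolding crossing_def by (meson subsetD)

lemma NC_iff_id:
  "P \<in> NC n \<longleftrightarrow> partition_on {1..n} P \<and> (\<forall>B\<in>P. \<forall>C\<in>P. B \<noteq> C \<longrightarrow> \<not> crossing id B C)"
proof (cases "partition_on {1..n} P")
  case True
  note part = True
  show ?thesis
  proof
    assume P: "P \<in> NC n"
    have "B = C" if "B \<in> P" "C \<in> P" "crossing id B C" for B C
    proof -
      obtain a b c d where *: "a \<in> B" "b \<in> B" "c \<in> C" "d \<in> C" "a < c" "c < b" "b < d"
        using \<open>crossing id B C\<close> by (auto simp: crossing_def)
      then have "1 \<le> a" "d \<le> n"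
        using that partition_onD1[OF part] by auto
      moreover have "same_block P a b" "same_block P c d"
        using * that by (auto simp: same_block_def)
      ultimately have "same_block P a c"
        using P * unfolding NC_def by blast
      then show ?thesis
        using * that partition_on_block_eq[OF part] by (metis same_block_def)
    qed
    then show "partition_on {1..n} P \<and> (\<forall>B\<in>P. \<forall>C\<in>P. B \<noteq> C \<longrightarrow> \<not> crossing id B C)"
      using part by blast
  next
    assume R: "partition_on {1..n} P \<and> (\<forall>B\<in>P. \<forall>C\<in>P. B \<noteq> C \<longrightarrow> \<not> crossing id B C)"
    have "same_block P i j"
      if less: "i < j" "j < k" "k < l" and "same_block P i k" "same_block P j l" for i j k l
    proof -
      obtain B C where BC: "B \<in> P" "C \<in> P" "i \<in> B" "k \<in> B" "j \<in> C" "l \<in> C"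
        using \<open>same_block P i k\<close> \<open>same_block P j l\<close> unfolding same_block_def by blast
      then have "crossing id B C"
        using less unfolding crossing_def id_def by blast
      then show ?thesis
        using R BC by (metis same_block_def)
    qed
    then show "P \<in> NC n"
      using part unfolding NC_def by blast
  qed
qed (simp add: NC_def)

text \<open>Noncrossingness is invariant under cyclic rotation of the points; the key \<open>k mod n\<close> puts
  the point \<open>n\<close> first.\<close>

lemma NC_iff:
  "P \<in> NC n \<longleftrightarrow> partition_on {1..n} P \<and>
     (\<forall>B\<in>P. \<forall>C\<in>P. B \<noteq> C \<longrightarrow> \<not> crossing (\<lambda>k. k mod n) B C)"
proof -
  have key: "k mod n = (if k = n then 0 else k)" if "k \<in> {1..n}" for k
    using that by auto
  have "crossing id B C \<or> crossing id C B \<longleftrightarrow>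
      crossing (\<lambda>k. k mod n) B C \<or> crossing (\<lambda>k. k mod n) C B"
    if BC: "B \<subseteq> {1..n}" "C \<subseteq> {1..n}" for B C
  proof -
    have "crossing id B C \<or> crossing id C B"
      if "crossing (\<lambda>k. k mod n) B C" "B \<subseteq> {1..n}" "C \<subseteq> {1..n}" for B C
    proof -
      obtain a b c d where *: "a \<in> B" "b \<in> B" "c \<in> C" "d \<in> C"
          "a mod n < c mod n" "c mod n < b mod n" "b mod n < d mod n"
        using \<open>crossing (\<lambda>k. k mod n) B C\<close> by (auto simp: crossing_def)
      moreover have "a \<in> {1..n}" "b \<in> {1..n}" "c \<in> {1..n}" "d \<in> {1..n}"
        using * that by auto
      \<comment> \<open>Only the smallest of the four keys can be 0, so only \<open>a\<close> can be
        the point \<open>n\<close>. Moving it from the front to the end exchanges the roles of the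
        two blocks.\<close>
      ultimately have "a < c \<and> c < b \<and> b < d \<or> c < b \<and> b < d \<and> d < a"
        by (auto simp: key split: if_splits)
      then show ?thesis
        using *(1-4) unfolding crossing_def id_def by blast
    qed
    moreover have "crossing (\<lambda>k. k mod n) B C \<or> crossing (\<lambda>k. k mod n) C B"
      if "crossing id B C" "B \<subseteq> {1..n}" "C \<subseteq> {1..n}" for B C
    proof -
      obtain a b c d where *: "a \<in> B" "b \<in> B" "c \<in> C" "d \<in> C" "a < c" "c < b" "b < d"
        using \<open>crossing id B C\<close> by (auto simp: crossing_def)
      moreover have "a \<in> {1..n}" "b \<in> {1..n}" "c \<in> {1..n}" "d \<in> {1..n}"
        using * that by auto
      ultimately have "a mod n < c mod n \<and> c mod n < b mod n \<and> b mod n < d mod n \<or>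
          d mod n < a mod n \<and> a mod n < c mod n \<and> c mod n < b mod n"
        by (auto simp: key split: if_splits)
      then show ?thesis
        using *(1-4) unfolding crossing_def by blast
    qed
    ultimately show ?thesis
      using BC by blast
  qed
  moreover have "B \<subseteq> {1..n}" if "partition_on {1..n} P" "B \<in> P" for B
    using partition_onD1[OF that(1)] that(2) by blast
  ultimately have rot: "crossing id B C \<or> crossing id C B \<longleftrightarrow>
      crossing (\<lambda>k. k mod n) B C \<or> crossing (\<lambda>k. k mod n) C B"
    if "partition_on {1..n} P" "B \<in> P" "C \<in> P" for B C
    using that by simp
  \<comment> \<open>Since rotation may swap the blocks, only the symmetrised relation is invariant;
    the condition over ordered pairs is therefore symmetrised first.\<close>
  have sym: "(\<forall>B\<in>P. \<forall>C\<in>P. B \<noteq> C \<longrightarrow> \<not> crossing f B C) \<longleftrightarrow>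
      (\<forall>B\<in>P. \<forall>C\<in>P. B \<noteq> C \<longrightarrow> \<not> (crossing f B C \<or> crossing f C B))" for f :: "nat \<Rightarrow> nat"
    by blast
  show ?thesis
    unfolding NC_iff_id sym by (intro conj_cong refl ball_cong imp_cong arg_cong[of _ _ Not] rot)
qed

section \<open>Block minima in the rotated order\<close>

text \<open>The value is a key and not a point: for a block of a partition of \<open>{1..n}\<close>
  that contains \<open>n\<close> it is 0.\<close>

definition rmin :: "nat \<Rightarrow> nat set \<Rightarrow> nat" where
  "rmin n B = Min ((\<lambda>k. k mod n) ` B)"

definition block_mins :: "nat \<Rightarrow> nat set set \<Rightarrow> nat set" where
  "block_mins n P = rmin n ` P"

lemma rmin_le: "finite B \<Longrightarrow> b \<in> B \<Longrightarrow> rmin n B \<le> b mod n"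
  by (simp add: rmin_def)

lemma rmin_attained:
  assumes "finite B" "B \<noteq> {}"
  obtains b where "b \<in> B" "b mod n = rmin n B"
proof -
  have "rmin n B \<in> (\<lambda>k. k mod n) ` B"
    unfolding rmin_def using assms by (intro Min_in) auto
  then show ?thesis using that by auto
qed

lemma rmin_eqI:
  assumes "finite B" "b \<in> B" "\<And>c. c \<in> B \<Longrightarrow> b mod n \<le> c mod n"
  shows "rmin n B = b mod n"
  unfolding rmin_def using assms by (intro Min_eqI) auto

lemma mod_eq_imp_eq:
  fixes a b n :: nat
  assumes "a mod n = b mod n" "a \<in> {1..n}" "b \<in> {1..n}"
  shows "a = b"
  using assms by (cases "a = n"; cases "b = n") auto

lemma block_finite_nonempty:
  fixes n :: nat
  assumes "partition_on {1..n} P" "B \<in> P"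
  shows "finite B" "B \<noteq> {}" "B \<subseteq> {1..n}"
proof -
  show "B \<subseteq> {1..n}" "B \<noteq> {}"
    using assms partition_onD1 partition_onD3 by blast+
  then show "finite B"
    using finite_subset by blast
qed

text \<open>Keys are injective on \<open>{1..n}\<close>, so the two blocks share the point that
  attains the minimum.\<close>

lemma refines_rmin_eq_imp_subset:
  assumes "refines {1..n} P Q" "B \<in> P" "D \<in> Q" "rmin n B = rmin n D"
  shows "B \<subseteq> D"
proof -
  have parts: "partition_on {1..n} P" "partition_on {1..n} Q"
    using assms(1) by (auto simp: refines_def)
  note B = block_finite_nonempty[OF parts(1) assms(2)]
  note D = block_finite_nonempty[OF parts(2) assms(3)]
  obtain b where b: "b \<in> B" "b mod n = rmin n B" using rmin_attained B by metis
  obtain d where d: "d \<in> D" "d mod n = rmin n D" using rmin_attained D by metis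
  have "b = d"
    using mod_eq_imp_eq[of b n d] b d B(3) D(3) assms(4) by (metis subsetD)
  then show ?thesis
    using refines_block_subset assms b(1) d(1) by metis
qed

lemma rmin_inj:
  assumes "partition_on {1..n} P" "B \<in> P" "C \<in> P" "rmin n B = rmin n C"
  shows "B = C"
  using refines_rmin_eq_imp_subset[OF refines_refl[OF assms(1)]] assms by (metis subset_antisym)

text \<open>Take the block of \<open>P\<close> through the point where \<open>D\<close> attains its
  minimum.\<close>

lemma refines_obtain_min_block:
  assumes "refines {1..n} P Q" "D \<in> Q"
  obtains B where "B \<in> P" "B \<subseteq> D" "rmin n B = rmin n D"
proof -
  have parts: "partition_on {1..n} P" "partition_on {1..n} Q"
    using assms(1) by (auto simp: refines_def)
  note D = block_finite_nonempty[OF parts(2) assms(2)]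
  obtain d where d: "d \<in> D" "d mod n = rmin n D" using rmin_attained D by metis
  obtain B where B: "B \<in> P" "d \<in> B"
    using partition_on_ex_block[OF parts(1)] d(1) D(3) by blast
  have "B \<subseteq> D"
    using refines_block_subset assms B d(1) by metis
  moreover have "rmin n B = rmin n D"
    unfolding d(2)[symmetric]
    using B(2) \<open>B \<subseteq> D\<close> D(1) rmin_le[OF D(1)] d(2)
    by (intro rmin_eqI) (auto intro: finite_subset)
  ultimately show ?thesis using that B(1) by blast
qed

lemma block_mins_antimono: "refines {1..n} P Q \<Longrightarrow> block_mins n Q \<subseteq> block_mins n P"
  unfolding block_mins_def by (rule image_subsetI) (metis imageI refines_obtain_min_block)

text \<open>Reduces survival of a minimum to a comparison with the surrounding block: any block of
  \<open>Q\<close> with the minimum of \<open>B\<close> contains \<open>B\<close>, hence is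
  \<open>D\<close>.\<close>

lemma rmin_in_block_mins_iff:
  assumes "refines {1..n} P Q" "B \<in> P" "D \<in> Q" "B \<subseteq> D"
  shows "rmin n B \<in> block_mins n Q \<longleftrightarrow> rmin n B = rmin n D"
proof
  have parts: "partition_on {1..n} P" "partition_on {1..n} Q"
    using assms(1) by (auto simp: refines_def)
  assume "rmin n B \<in> block_mins n Q"
  then obtain D' where D': "D' \<in> Q" "rmin n B = rmin n D'"
    by (auto simp: block_mins_def)
  then have "B \<subseteq> D'"
    using refines_rmin_eq_imp_subset assms by blast
  moreover obtain x where "x \<in> B"
    using block_finite_nonempty(2)[OF parts(1) assms(2)] by blast
  ultimately have "D' = D"
    using partition_on_block_eq[OF parts(2) D'(1) assms(3)] assms(4) by blast
  then show "rmin n B = rmin n D" using D' by simp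
next
  assume "rmin n B = rmin n D"
  then show "rmin n B \<in> block_mins n Q"
    using assms(3) by (simp add: block_mins_def)
qed

text \<open>If no minimum were lost, all blocks of \<open>P\<close> inside a block \<open>D\<close>
  of \<open>Q\<close> would share the minimum of \<open>D\<close> and so be one block, which makes
  \<open>Q\<close> refine \<open>P\<close>.\<close>

lemma block_mins_diff_nonempty:
  assumes "refines {1..n} P Q" "P \<noteq> Q"
  shows "block_mins n P - block_mins n Q \<noteq> {}"
proof
  assume "block_mins n P - block_mins n Q = {}"
  then have mins: "rmin n B \<in> block_mins n Q" if "B \<in> P" for B
    using that by (auto simp: block_mins_def)
  have parts: "partition_on {1..n} P" "partition_on {1..n} Q"
    using assms(1) by (auto simp: refines_def)
  have "D \<in> P" if "D \<in> Q" for D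
  proof -
    obtain B where B: "B \<in> P" "B \<subseteq> D" "rmin n B = rmin n D"
      using refines_obtain_min_block[OF assms(1) \<open>D \<in> Q\<close>] by blast
    have "x \<in> B" if "x \<in> D" for x
    proof -
      obtain C where C: "C \<in> P" "x \<in> C"
        using partition_on_ex_block[OF parts(1)] \<open>x \<in> D\<close>
          block_finite_nonempty(3)[OF parts(2) \<open>D \<in> Q\<close>]
        by blast
      then have "C \<subseteq> D"
        using refines_block_subset assms(1) \<open>D \<in> Q\<close> that by metis
      then have "rmin n C = rmin n B"
        using rmin_in_block_mins_iff[OF assms(1) C(1) \<open>D \<in> Q\<close>] mins C(1) B(3) by simp
      then show ?thesis
        using rmin_inj[OF parts(1) C(1) B(1)] C(2) by simp
    qed
    then show ?thesis using B by (metis subsetI subset_antisym)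
  qed
  then have "refines {1..n} Q P"
    using parts by (auto simp: refines_def)
  then show False
    using refines_asym assms by blast
qed

section \<open>Greedy merging of blocks within \<open>PE n\<close>\<close>

text \<open>A crossing with the union, in either order, puts a point of \<open>B\<close> or
  \<open>B'\<close> between two points of \<open>C\<close>. Adding the early point \<open>x\<close>
  or \<open>x'\<close> of the same block gives a crossing of that block with
  \<open>C\<close>.\<close>

lemma not_crossing_Un:
  fixes f :: "'a \<Rightarrow> 'b::linorder"
  assumes "\<not> crossing f B C" "\<not> crossing f B' C"
    and "x \<in> B" "x' \<in> B'" "\<And>c. c \<in> C \<Longrightarrow> f x < f c" "\<And>c. c \<in> C \<Longrightarrow> f x' < f c"
  shows "\<not> crossing f (B \<union> B') C" "\<not> crossing f C (B \<union> B')"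
proof -
  have sandwich: False if "b \<in> B \<union> B'" "c \<in> C" "d \<in> C" "f c < f b" "f b < f d" for b c d
  proof (cases "b \<in> B")
    case True
    then show ?thesis
      using assms(1,3) assms(5)[OF that(2)] that unfolding crossing_def by blast
  next
    case False
    then show ?thesis
      using assms(2,4) assms(6)[OF that(2)] that unfolding crossing_def by blast
  qed
  then show "\<not> crossing f (B \<union> B') C" "\<not> crossing f C (B \<union> B')"
    unfolding crossing_def by blast+
qed

lemma PE_partition_on: "P \<in> PE n \<Longrightarrow> partition_on {1..n} P"
  by (simp add: PE_def NC_def)

text \<open>Here \<open>B\<close> is the block of \<open>u\<close> with minimum \<open>m\<close>,
  \<open>D\<close> the block of \<open>v\<close> around it, and \<open>B0\<close> the block of
  \<open>u\<close> that has the minimum of \<open>D\<close>. The witness \<open>w\<close> merges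
  \<open>B0\<close> and \<open>B\<close>.\<close>

lemma PE_greedy_step:
  assumes n: "n \<ge> 3" and u: "u \<in> PE n" and v: "v \<in> PE n"
    and uv: "refines {1..n} u v" and ne: "u \<noteq> v"
  defines "m \<equiv> Min (block_mins n u - block_mins n v)"
  shows "\<exists>w\<in>PE n. refines {1..n} u w \<and> refines {1..n} w v \<and>
    block_mins n w = block_mins n u - {m} \<and>
    (\<forall>w'\<in>PE n. refines {1..n} u w' \<longrightarrow> refines {1..n} w' v \<longrightarrow> m \<notin> block_mins n w' \<longrightarrow>
      refines {1..n} w w')"
proof -
  let ?key = "\<lambda>k. k mod n"
  note pu = PE_partition_on[OF u] and pv = PE_partition_on[OF v]
  have fin: "finite (block_mins n u)"
    unfolding block_mins_def by (intro finite_imageI finite_elements[OF _ pu]) simp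
  have m: "m \<in> block_mins n u - block_mins n v"
    unfolding m_def using fin block_mins_diff_nonempty[OF uv ne] by (intro Min_in) auto
  have m_least: "m \<le> k" if "k \<in> block_mins n u" "k \<notin> block_mins n v" for k
    unfolding m_def using fin that by simp
  obtain B where B: "B \<in> u" "rmin n B = m"
    using m by (auto simp: block_mins_def)
  obtain D where D: "D \<in> v" "B \<subseteq> D"
    using uv B(1) by (auto simp: refines_def)
  obtain B0 where B0: "B0 \<in> u" "B0 \<subseteq> D" "rmin n B0 = rmin n D"
    using refines_obtain_min_block[OF uv D(1)] by blast
  note fB = block_finite_nonempty[OF pu B(1)]
  note fB0 = block_finite_nonempty[OF pu B0(1)]
  note fD = block_finite_nonempty[OF pv D(1)]
  have "rmin n D \<noteq> m"
    using m D(1) unfolding block_mins_def by (metis DiffD2 imageI)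
  then have "B \<noteq> B0"
    using B B0 by auto
  then have disj: "B \<inter> B0 = {}"
    using partition_on_block_eq[OF pu] B(1) B0(1) by blast
  obtain b where b: "b \<in> B" "b mod n = m"
    using rmin_attained fB B(2) by metis
  obtain b0 where b0: "b0 \<in> B0" "b0 mod n = rmin n D"
    using rmin_attained fB0 B0(3) by metis
  have m0: "rmin n D < m"
    using rmin_le[OF fD(1)] b D(2) \<open>rmin n D \<noteq> m\<close> by (metis order_less_le subsetD)
  \<comment> \<open>A third block inside \<open>D\<close> does not have the minimum of
    \<open>D\<close>, so its own minimum is lost too and cannot precede \<open>m\<close>;
    injectivity makes the inequality strict.\<close>
  have other: "m < c mod n" if "C \<in> u" "C \<noteq> B" "C \<noteq> B0" "C \<subseteq> D" "c \<in> C" for C c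
  proof -
    have "rmin n C \<noteq> rmin n D" "rmin n C \<noteq> m"
      using rmin_inj[OF pu] that B B0 by metis+
    moreover from this have "m \<le> rmin n C"
      using rmin_in_block_mins_iff[OF uv \<open>C \<in> u\<close> D(1) \<open>C \<subseteq> D\<close>] m_least that(1)
      by (simp add: block_mins_def)
    moreover have "rmin n C \<le> c mod n"
      using rmin_le block_finite_nonempty[OF pu that(1)] that(5) by blast
    ultimately show ?thesis by simp
  qed
  define w where "w = insert (B0 \<union> B) (u - {B0, B})"
  have pw: "partition_on {1..n} w"
    unfolding w_def using partition_on_merge[OF pu B0(1) B(1)] .
  have ncu: "\<not> crossing ?key X Y" if "X \<in> u" "Y \<in> u" "X \<noteq> Y" for X Y
    using u that unfolding PE_def NC_iff by blast
  have ncv: "\<not> crossing ?key X Y" if "X \<in> v" "Y \<in> v" "X \<noteq> Y" for X Y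
    using v that unfolding PE_def NC_iff by blast
  have ncw: "\<not> crossing ?key (B0 \<union> B) C \<and> \<not> crossing ?key C (B0 \<union> B)"
    if "C \<in> u" "C \<noteq> B" "C \<noteq> B0" for C
  proof -
    obtain E where E: "E \<in> v" "C \<subseteq> E"
      using uv \<open>C \<in> u\<close> by (auto simp: refines_def)
    show ?thesis
    \<comment> \<open>For \<open>C\<close> outside \<open>D\<close>, a crossing would enlarge to one
      of the blocks \<open>D\<close> and \<open>E\<close> of \<open>v\<close>. Inside
      \<open>D\<close>, both merged blocks start before all of \<open>C\<close>.\<close>
    proof (cases "E = D")
      case False
      then have "\<not> crossing ?key D E" "\<not> crossing ?key E D"
        using ncv E(1) D(1) by auto
      then show ?thesis
        using crossing_mono[of ?key "B0 \<union> B" C D E] crossing_mono[of ?key C "B0 \<union> B" E D]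
          E(2) D(2) B0(2) by blast
    next
      case True
      then have after: "b0 mod n < c mod n" "b mod n < c mod n" if "c \<in> C" for c
        using other[OF \<open>C \<in> u\<close> \<open>C \<noteq> B\<close> \<open>C \<noteq> B0\<close> _ that] E(2) m0 b(2) b0(2) by auto
      have "\<not> crossing ?key B0 C" "\<not> crossing ?key B C"
        using ncu B(1) B0(1) that by auto
      from not_crossing_Un[OF this b0(1) b(1) after] show ?thesis
        by blast
    qed
  qed
  have "\<not> crossing ?key X Y" if "X \<in> w" "Y \<in> w" "X \<noteq> Y" for X Y
    using that ncu[of X Y] ncw[of X] ncw[of Y] by (auto simp: w_def)
  then have "w \<in> NC n"
    unfolding NC_iff using pw by blast
  \<comment> \<open>If the merged block were \<open>{n - 1, n}\<close>, then \<open>m\<close> would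
    be the largest key \<open>n - 1\<close>. No third block could follow it inside \<open>D\<close>,
    so \<open>D\<close> would be the forbidden block of \<open>v\<close>.\<close>
  moreover have "{n - 1, n} \<notin> w"
  proof
    assume "{n - 1, n} \<in> w"
    moreover have "{n - 1, n} \<notin> u"
      using u by (simp add: PE_def)
    ultimately have BB: "B0 \<union> B = {n - 1, n}"
      by (auto simp: w_def)
    have "b \<noteq> n"
      using b m0 by auto
    then have "b = n - 1"
      using b(1) BB by blast
    then have "m = n - 1"
      using b(2) n by simp
    have "x \<in> B0 \<union> B" if "x \<in> D" for x
    proof (rule ccontr)
      assume x: "x \<notin> B0 \<union> B"
      obtain C where C: "C \<in> u" "x \<in> C"
        using partition_on_ex_block[OF pu] \<open>x \<in> D\<close> fD(3) by blast
      then have "C \<subseteq> D"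
        using refines_block_subset[OF uv] D(1) that by metis
      then have "m < x mod n"
        using other[OF C(1)] C(2) x by blast
      moreover have "x mod n < n"
        using n by simp
      ultimately show False
        using \<open>m = n - 1\<close> by linarith
    qed
    then have "D = {n - 1, n}"
      using BB B0(2) D(2) by blast
    then show False
      using v D(1) by (simp add: PE_def)
  qed
  \<comment> \<open>Otherwise \<open>{n}\<close> is already a block of \<open>u\<close>, so the
    merge is what joins 1 and \<open>n - 1\<close>, and both lie in \<open>D\<close>. The block
    \<open>E\<close> of \<open>n\<close> in \<open>v\<close> is not \<open>D\<close>, and it is not
    \<open>{n}\<close> because \<open>v\<close> is in \<open>PE n\<close>. Hence it has a point
    \<open>k\<close> strictly between 1 and \<open>n - 1\<close>, and \<open>E\<close> crosses
    \<open>D\<close> at \<open>n\<close>, 1, \<open>k\<close>, \<open>n - 1\<close> in rotated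
    order.\<close>
  moreover have "\<not> (same_block w 1 (n - 1) \<and> {n} \<in> w)"
  proof
    assume *: "same_block w 1 (n - 1) \<and> {n} \<in> w"
    have "{n} \<noteq> B0 \<union> B"
      using disj fB(2) fB0(2) by (metis Int_absorb2 Un_upper1 Un_upper2 inf_commute subset_singletonD)
    then have nu: "{n} \<in> u" "{n} \<noteq> B0" "{n} \<noteq> B"
      using * by (auto simp: w_def)
    then have "\<not> same_block u 1 (n - 1)"
      using u by (simp add: PE_def)
    moreover obtain X where X: "X \<in> w" "1 \<in> X" "n - 1 \<in> X"
      using * by (auto simp: same_block_def)
    ultimately have "X = B0 \<union> B"
      by (auto simp: same_block_def w_def)
    then have D1: "1 \<in> D" "n - 1 \<in> D"
      using X B0(2) D(2) by auto
    obtain E where E: "E \<in> v" "n \<in> E"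
      using uv nu(1) by (auto simp: refines_def)
    have "n \<notin> D"
    proof
      assume "n \<in> D"
      \<comment> \<open>As \<open>n\<close> has key 0, it would be the first point of
        \<open>D\<close> and hence lie in \<open>B0\<close>.\<close>
      then have "rmin n D = 0"
        using rmin_le[OF fD(1), of n n] by simp
      then have "b0 = n"
        using b0 fB0(3) n mod_eq_imp_eq[of b0 n n] by auto
      then show False
        using partition_on_block_eq[OF pu nu(1) B0(1)] nu(2) b0(1) by blast
    qed
    then have "E \<noteq> D" using E(2) by blast
    have "same_block v 1 (n - 1)"
      using D1 D(1) by (auto simp: same_block_def)
    then have "E \<noteq> {n}"
      using v E(1) by (auto simp: PE_def)
    then obtain k where k: "k \<in> E" "k \<noteq> n"
      using E(2) by blast
    have "k \<notin> D"
      using partition_on_block_eq[OF pv E(1) D(1)] k(1) \<open>E \<noteq> D\<close> by blast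
    then have "k \<noteq> 1" "k \<noteq> n - 1"
      using D1 by auto
    moreover have "1 \<le> k" "k \<le> n"
      using block_finite_nonempty(3)[OF pv E(1)] k(1) by auto
    ultimately have "n mod n < 1 mod n \<and> 1 mod n < k mod n \<and> k mod n < (n - 1) mod n"
      using k(2) n by simp
    then have "crossing ?key E D"
      unfolding crossing_def using E(2) k(1) D1 by blast
    then show False
      using ncv E(1) D(1) \<open>E \<noteq> D\<close> by blast
  qed
  ultimately have wPE: "w \<in> PE n"
    by (simp add: PE_def)
  have uw: "refines {1..n} u w"
    using pu pw by (auto simp: refines_def w_def)
  have wv: "refines {1..n} w v"
    using pw pv uv D B0(2) by (auto simp: refines_def w_def)
  have mins_w: "block_mins n w = block_mins n u - {m}"
  proof -
    have "rmin n (B0 \<union> B) = rmin n B0"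
      unfolding B0(3) b0(2)[symmetric]
      using fB(1) fB0(1) b0 rmin_le[OF fD(1)] B0(2) D(2) by (intro rmin_eqI) auto
    then have "block_mins n w = block_mins n (u - {B})"
      using B0(1) \<open>B \<noteq> B0\<close> by (auto simp: block_mins_def w_def)
    also have "\<dots> = block_mins n u - {m}"
      using rmin_inj[OF pu] B by (auto simp: block_mins_def)
    finally show ?thesis .
  qed
  \<comment> \<open>The block \<open>D'\<close> of \<open>w'\<close> around \<open>B\<close> has a
    minimum below \<open>m\<close>, which by the choice of \<open>m\<close> survives in
    \<open>v\<close> and so is that of \<open>D\<close>. Thus \<open>D'\<close> contains
    \<open>B0\<close> as well as \<open>B\<close>.\<close>
  have "refines {1..n} w w'"
    if w': "refines {1..n} u w'" "refines {1..n} w' v" "m \<notin> block_mins n w'" for w'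
  proof -
    have pw': "partition_on {1..n} w'"
      using w'(1) by (simp add: refines_def)
    obtain D' where D': "D' \<in> w'" "B \<subseteq> D'"
      using w'(1) B(1) by (auto simp: refines_def)
    note fD' = block_finite_nonempty[OF pw' D'(1)]
    have "D' \<subseteq> D"
      using refines_block_subset[OF w'(2) D'(1) D(1)] b(1) D(2) D'(2) by blast
    have in_w': "rmin n D' \<in> block_mins n w'"
      using D'(1) by (simp add: block_mins_def)
    then have "rmin n D' \<noteq> m"
      using w'(3) by auto
    moreover have "rmin n D' \<le> m"
      using rmin_le[OF fD'(1)] b D'(2) by blast
    ultimately have "rmin n D' \<in> block_mins n v"
      using m_least[of "rmin n D'"] block_mins_antimono[OF w'(1)] in_w' by auto
    then have "rmin n D' = rmin n B0"
      using rmin_in_block_mins_iff[OF w'(2) D'(1) D(1) \<open>D' \<subseteq> D\<close>] B0(3) by simp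
    then have "B0 \<subseteq> D'"
      using refines_rmin_eq_imp_subset[OF w'(1) B0(1) D'(1)] by simp
    then show ?thesis
      using pw pw' w'(1) D' by (auto simp: refines_def w_def)
  qed
  then show ?thesis
    using wPE uw wv mins_w by (intro bexI[of _ w]) simp_all
qed

section \<open>Finiteness and bounds of \<open>PE n\<close>, and the resulting EL-labeling\<close>

lemma finite_PE: "finite (PE n)"
proof (rule finite_subset)
  show "PE n \<subseteq> Pow (Pow {1..n})"
    using PE_partition_on partition_onD1 by blast
qed simp

lemma bot_in_PE:
  assumes "n \<ge> 3"
  shows "(\<lambda>k. {k}) ` {1..n} \<in> PE n"
proof -
  have "{n - 1, n} \<notin> (\<lambda>k. {k}) ` {1..n}"
    using assms by (auto simp: doubleton_eq_iff)
  \<comment> \<open>Here \<open>n \<ge> 3\<close> enters by making 1 and \<open>n - 1\<close>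
    distinct points.\<close>
  moreover have "\<not> same_block ((\<lambda>k. {k}) ` {1..n}) 1 (n - 1)"
    using assms by (auto simp: same_block_def)
  ultimately show ?thesis
    by (auto simp: PE_def NC_iff_id partition_on_singletons crossing_def)
qed

lemma top_in_PE:
  assumes "n \<ge> 3"
  shows "{{1..n}} \<in> PE n"
proof -
  have "1 \<notin> {n - 1, n}" "1 \<notin> {n}" "1 \<in> {1..n}"
    using assms by auto
  then have "{n - 1, n} \<noteq> {1..n}" "{n} \<noteq> {1..n}"
    by blast+
  then show ?thesis
    using assms by (simp add: PE_def NC_iff_id partition_on_space)
qed

lemma finite_bounded_poset_PE:
  assumes "n \<ge> 3"
  shows "finite_bounded_poset (PE n) (Restr (dref n) (PE n))"
proof -
  have "partial_order_on (PE n) (Restr (dref n) (PE n))"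
    by (auto simp: partial_order_on_def preorder_on_def dref_def refl_on_def
        simp del: One_nat_def
        intro!: transI antisymI refines_refl PE_partition_on
        dest: refines_trans refines_asym)
  moreover have "refines {1..n} ((\<lambda>k. {k}) ` {1..n}) P" if "P \<in> PE n" for P
  proof -
    have "\<exists>Y\<in>P. {k} \<subseteq> Y" if "k \<in> {1..n}" for k
      using partition_on_ex_block[OF PE_partition_on[OF \<open>P \<in> PE n\<close>] that] by blast
    then show ?thesis
      using PE_partition_on[OF that] by (auto simp: refines_def partition_on_singletons)
  qed
  moreover have "refines {1..n} P {{1..n}}" if "P \<in> PE n" for P
    using PE_partition_on[OF that] assms partition_onD1
    by (fastforce simp: refines_def intro: partition_on_space)
  ultimately show ?thesis
    unfolding finite_bounded_poset_def
    using finite_PE bot_in_PE[OF assms] top_in_PE[OF assms]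
    by (auto simp: dref_def)
qed

theorem corollary3p6:
  fixes n :: nat
  assumes "n \<ge> 3"
  shows "EL_shellable (PE n) (Restr (dref n) (PE n))"
proof -
  \<comment> \<open>The labels are keys of block minima in the usual order of the naturals, so the
    label poset is a chain.\<close>
  interpret greedy_labeled_poset "PE n" "Restr (dref n) (PE n)" "block_mins n"
  proof
    show "finite_bounded_poset (PE n) (Restr (dref n) (PE n))"
      by (rule finite_bounded_poset_PE[OF assms])
    show "finite (block_mins n u)" if "u \<in> PE n" for u
      unfolding block_mins_def
      by (intro finite_imageI finite_elements[OF _ PE_partition_on[OF that]]) simp
    fix u v
    assume "(u, v) \<in> Restr (dref n) (PE n)"
    then have uv: "u \<in> PE n" "v \<in> PE n" "refines {1..n} u v"
      by (auto simp: dref_def)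
    show "block_mins n v \<subseteq> block_mins n u"
      by (rule block_mins_antimono[OF uv(3)])
    assume "u \<noteq> v"
    from block_mins_diff_nonempty[OF uv(3) this] PE_greedy_step[OF assms uv this] uv(1,2)
    show "block_mins n u - block_mins n v \<noteq> {} \<and>
      (\<exists>w. (u, w) \<in> Restr (dref n) (PE n) \<and> (w, v) \<in> Restr (dref n) (PE n) \<and>
        block_mins n w = block_mins n u - {Min (block_mins n u - block_mins n v)} \<and>
        (\<forall>w'. (u, w') \<in> Restr (dref n) (PE n) \<longrightarrow> (w', v) \<in> Restr (dref n) (PE n) \<longrightarrow>
          Min (block_mins n u - block_mins n v) \<notin> block_mins n w' \<longrightarrow>
          (w, w') \<in> Restr (dref n) (PE n)))"
      by (simp add: dref_def) blast
  qed
  show ?thesis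
    unfolding EL_shellable_def using EL_labeling_min_lab by blast
qed

end
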